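(* For every $d\geq 3$ there exist a $d$-dimensional polytope $P\subset\mathbb R^d$ that is combinatorially isomorphic to the $d$-cube and a direction $\mathbf c\in\mathbb R^d$ such that neither the sequence $(N_\ell)_\ell$ of the numbers of $\mathbf c$-monotone paths of length $\ell$ on $P$, nor the sequence $(N^{\mathrm{coh}}_\ell)_\ell$ of the numbers of coherent $\mathbf c$-monotone paths of length $\ell$ on $P$, is unimodal.
   Context: For a polytope $P\subset\mathbb R^d$ and $\mathbf c\in\mathbb R^d$ such that $\langle\cdot,\mathbf c\rangle$ attains its minimum and maximum over $P$ at unique vertices $v_{\min}$, $v_{\max}$, let $G_{P,\mathbf c}$ be the directed graph on the vertices of $P$ with an arc $u\to v$ whenever $[u,v]$ is an edge of $P$ with $\langle u,\mathbf c\rangle<\langle v,\mathbf c\rangle$. A $\mathbf c$-monotone path is a directed path in $G_{P,\mathbf c}$ from $v_{\min}$ to $v_{\max}$; its length is its number of edges. Such a path is coherent if there is $\boldsymbol\omega\in\mathbb R^d$ linearly independent from $\mathbf c$ such that the path is exactly the set of preimages, under $x\mapsto(\langle x,\mathbf c\rangle,\langle x,\boldsymbol\omega\rangle)$, of the upper faces of the polygon $\{(\langle x,\mathbf c\rangle,\langle x,\boldsymbol\omega\rangle):x\in P\}$, where a vertex or edge of the polygon is an upper face if it has an outer normal vector with positive second coordinate. A finite sequence $(a_1,\dots,a_r)$ is unimodal if there is $k$ with $a_i\le a_{i+1}$ for $i<k$ and $a_i\ge a_{i+1}$ for $i\ge k$. *)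

theory Defs
  imports "HOL-Analysis.Analysis"
begin

definition combinatorially_isomorphic ::
  "'a::real_vector set \<Rightarrow> 'b::real_vector set \<Rightarrow> bool" where
  "combinatorially_isomorphic P Q \<longleftrightarrow>
     (\<exists>\<phi>. bij_betw \<phi> {F. F face_of P} {G. G face_of Q} \<and>
          (\<forall>F G. F face_of P \<longrightarrow> G face_of P \<longrightarrow> (F \<subseteq> G \<longleftrightarrow> \<phi> F \<subseteq> \<phi> G)))"

definition min_vertex :: "'a::real_inner set \<Rightarrow> 'a \<Rightarrow> 'a \<Rightarrow> bool" where
  "min_vertex P c v \<longleftrightarrow> v extreme_point_of P \<and> (\<forall>x\<in>P. v \<bullet> c \<le> x \<bullet> c)"

definition max_vertex :: "'a::real_inner set \<Rightarrow> 'a \<Rightarrow> 'a \<Rightarrow> bool" where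
  "max_vertex P c v \<longleftrightarrow> v extreme_point_of P \<and> (\<forall>x\<in>P. x \<bullet> c \<le> v \<bullet> c)"

definition unique_extrema :: "'a::real_inner set \<Rightarrow> 'a \<Rightarrow> bool" where
  "unique_extrema P c \<longleftrightarrow> (\<exists>!v. min_vertex P c v) \<and> (\<exists>!v. max_vertex P c v)"

definition monotone_arc :: "'a::euclidean_space set \<Rightarrow> 'a \<Rightarrow> 'a \<Rightarrow> 'a \<Rightarrow> bool" where
  "monotone_arc P c u v \<longleftrightarrow>
     u extreme_point_of P \<and> v extreme_point_of P \<and>
     closed_segment u v edge_of P \<and> u \<bullet> c < v \<bullet> c"

text \<open>A path is represented by its list of vertices; it is automatically without repetition,
  since the values of the linear functional increase strictly along arcs. Its number of edges is
  one less than the length of the list.\<close>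

definition monotone_path :: "'a::euclidean_space set \<Rightarrow> 'a \<Rightarrow> 'a list \<Rightarrow> bool" where
  "monotone_path P c p \<longleftrightarrow>
     p \<noteq> [] \<and> min_vertex P c (hd p) \<and> max_vertex P c (last p) \<and>
     successively (monotone_arc P c) p"

definition path_length :: "'a list \<Rightarrow> nat" where
  "path_length p = length p - 1"

definition path_cells :: "'a::real_vector list \<Rightarrow> 'a set set" where
  "path_cells p =
     {{v} | v. v \<in> set p} \<union> {closed_segment (p ! i) (p ! Suc i) | i. Suc i < length p}"

definition plane_proj :: "'a::real_inner \<Rightarrow> 'a \<Rightarrow> 'a \<Rightarrow> real \<times> real" where
  "plane_proj c \<omega> x = (x \<bullet> c, x \<bullet> \<omega>)"

definition upper_face :: "(real \<times> real) set \<Rightarrow> (real \<times> real) set \<Rightarrow> bool" where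
  "upper_face Q F \<longleftrightarrow>
     F face_of Q \<and> (aff_dim F = 0 \<or> aff_dim F = 1) \<and>
     (\<exists>n. snd n > 0 \<and> (\<forall>y\<in>F. \<forall>z\<in>Q. z \<bullet> n \<le> y \<bullet> n))"

text \<open>The conjunct \<open>c \<noteq> \<omega>\<close> is needed because \<open>independent\<close> speaks about a set,
  and \<open>{c, c}\<close> collapses to a singleton.\<close>

definition coherent :: "'a::euclidean_space set \<Rightarrow> 'a \<Rightarrow> 'a list \<Rightarrow> bool" where
  "coherent P c p \<longleftrightarrow>
     (\<exists>\<omega>. c \<noteq> \<omega> \<and> independent {c, \<omega>} \<and>
          path_cells p =
            {{x \<in> P. plane_proj c \<omega> x \<in> F} | F. upper_face (plane_proj c \<omega> ` P) F})"

definition num_paths :: "'a::euclidean_space set \<Rightarrow> 'a \<Rightarrow> nat \<Rightarrow> nat" where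
  "num_paths P c l = card {p. monotone_path P c p \<and> path_length p = l}"

definition num_coherent_paths :: "'a::euclidean_space set \<Rightarrow> 'a \<Rightarrow> nat \<Rightarrow> nat" where
  "num_coherent_paths P c l =
     card {p. monotone_path P c p \<and> coherent P c p \<and> path_length p = l}"

definition unimodal :: "nat list \<Rightarrow> bool" where
  "unimodal a \<longleftrightarrow>
     (\<exists>k. \<forall>i. Suc i < length a \<longrightarrow>
        (i < k \<longrightarrow> a ! i \<le> a ! Suc i) \<and> (k \<le> i \<longrightarrow> a ! i \<ge> a ! Suc i))"

text \<open>A path without repeated vertices has fewer edges than \<open>P\<close> has vertices, so these are all
  lengths that can occur. Zeros at either end do not affect unimodality of a sequence of
  natural numbers, so restricting to the range from the least to the greatest length that
  occurs would give the same notion.\<close>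

definition length_sequence :: "'a::euclidean_space set \<Rightarrow> (nat \<Rightarrow> nat) \<Rightarrow> nat list" where
  "length_sequence P N = map N [0..<card {v. v extreme_point_of P}]"

end

theory Submission imports Defs begin

text \<open>
  The graph of the cube is bipartite, so on a combinatorial cube all monotone paths have lengths of
  the same parity. Hence it suffices to find coherent monotone paths of two lengths \<open>\<ell>\<close> and
  \<open>\<ell> + 2\<close>: then \<open>N (\<ell> + 1) = 0\<close> lies strictly between two positive values, for all paths and for
  the coherent ones alike.

  Take the frustum \<open>0 \<le> x\<^sub>k \<le> 1\<close>, \<open>0 \<le> x\<^sub>j \<le> 2 - x\<^sub>k\<close> for \<open>j \<noteq> k\<close>, the image of the unit cube under
  the projective map \<open>x \<mapsto> 2 x / (1 + x\<^sub>k)\<close>, with the direction that is 1 at \<open>k\<close> and 2 elsewhere.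
  The minimum and the maximum both have \<open>x\<^sub>k = 0\<close>. One coherent path stays in the facet \<open>x\<^sub>k = 0\<close> and
  has length \<open>d - 1\<close>; another first moves to the facet \<open>x\<^sub>k = 1\<close>, crosses it and returns at the
  end, which gives length \<open>d + 1\<close>.
\<close>

section \<open>Coherent paths from exposed edges\<close>

definition support_face :: "'a::real_inner set \<Rightarrow> 'a \<Rightarrow> 'a set" where
  "support_face P w = {x \<in> P. \<forall>y\<in>P. y \<bullet> w \<le> x \<bullet> w}"

text \<open>Any point of \<open>S\<close> attains \<open>M\<close>, so the nonemptiness of
  \<open>S\<close> turns the bound \<open>M\<close> into the maximum.\<close>

lemma support_face_eqI:
  assumes "\<And>x. x \<in> P \<Longrightarrow> x \<bullet> w \<le> M"
    and "\<And>x. x \<in> P \<and> x \<bullet> w = M \<longleftrightarrow> x \<in> S" and "S \<noteq> {}"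
  shows "support_face P w = S"
proof -
  obtain z where z: "z \<in> P" "z \<bullet> w = M" using assms(2,3) by blast
  have "x \<in> P \<and> (\<forall>y\<in>P. y \<bullet> w \<le> x \<bullet> w) \<longleftrightarrow> x \<in> P \<and> x \<bullet> w = M" for x
    using assms(1) z by (metis antisym)
  then show ?thesis using assms(2) by (auto simp: support_face_def)
qed

lemma support_face_face_of:
  assumes "convex P"
  shows "support_face P w face_of P"
proof (cases "support_face P w = {}")
  case False
  then obtain z where z: "z \<in> P" "\<And>y. y \<in> P \<Longrightarrow> y \<bullet> w \<le> z \<bullet> w"
    by (auto simp: support_face_def)
  have "support_face P w = P \<inter> {x. w \<bullet> x = w \<bullet> z}"
    using z by (force simp: support_face_def inner_commute[of w])
  moreover have "P \<inter> {x. w \<bullet> x = w \<bullet> z} face_of P"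
    using z by (intro face_of_Int_supporting_hyperplane_le assms) (simp add: inner_commute[of w])
  ultimately show ?thesis by simp
qed simp

lemma aff_dim_closed_segment:
  fixes a b :: "'a::euclidean_space"
  assumes "a \<noteq> b"
  shows "aff_dim (closed_segment a b) = 1"
  using assms by (simp add: segment_convex_hull aff_dim_convex_hull)

text \<open>A point of the open segment in \<open>F\<close> forces both ends into \<open>F\<close>,
  and convexity then fills the segment. Without such a point \<open>F\<close> lies in
  \<open>{a, b}\<close>.\<close>

lemma face_of_closed_segment_cases:
  assumes "F face_of closed_segment a b" "F \<noteq> {}"
  shows "F = {a} \<or> F = {b} \<or> F = closed_segment a b"
proof -
  have sub: "F \<subseteq> closed_segment a b" and conv: "convex F"
    using assms face_of_imp_subset face_of_imp_convex by auto
  have whole: "F = closed_segment a b" if "a \<in> F" "b \<in> F"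
    using that sub conv convex_contains_segment by blast
  show ?thesis
  proof (cases "F \<subseteq> {a, b}")
    case True
    then show ?thesis using whole assms(2) by blast
  next
    case False
    then obtain x where x: "x \<in> F" "x \<in> open_segment a b"
      using sub by (auto simp: open_segment_def)
    then have "a \<in> F \<and> b \<in> F"
      using face_ofD[OF assms(1) x(2)] by simp
    then show ?thesis using whole by blast
  qed
qed

text \<open>The edge from \<open>v i\<close> to \<open>v (Suc i)\<close> projects to the upper edge of slope \<open>s i\<close> of the polygon.\<close>

locale upper_path =
  fixes P :: "'a::euclidean_space set" and c \<omega> :: 'a
    and v :: "nat \<Rightarrow> 'a" and s :: "nat \<Rightarrow> real" and n :: nat
  assumes convex: "convex P"
    and pos: "n > 0"
    and edge: "\<And>i. i < n \<Longrightarrow> support_face P (\<omega> - s i *\<^sub>R c) = closed_segment (v i) (v (Suc i))"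
    and dec: "\<And>i. Suc i < n \<Longrightarrow> s (Suc i) < s i"
    and inc: "\<And>i. i < n \<Longrightarrow> v i \<bullet> c < v (Suc i) \<bullet> c"
    and least: "support_face P (- c) = {v 0}"
    and greatest: "support_face P c = {v n}"
begin

text \<open>The height \<open>x \<bullet> c\<close> grows strictly along each edge, so an end is the
  only point of the edge at its height. This later identifies the preimages of the projected
  vertices.\<close>

lemma segment_height:
  assumes "i < n" "x \<in> closed_segment (v i) (v (Suc i))"
  shows "v i \<bullet> c \<le> x \<bullet> c" "x \<bullet> c \<le> v (Suc i) \<bullet> c"
    "x \<bullet> c = v i \<bullet> c \<Longrightarrow> x = v i" "x \<bullet> c = v (Suc i) \<bullet> c \<Longrightarrow> x = v (Suc i)"
proof -
  obtain u where u: "0 \<le> u" "u \<le> 1" "x = (1 - u) *\<^sub>R v i + u *\<^sub>R v (Suc i)"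
    using assms by (auto simp: in_segment)
  define D where "D = v (Suc i) \<bullet> c - v i \<bullet> c"
  have D: "D > 0" using inc[OF assms(1)] by (simp add: D_def)
  have *: "x \<bullet> c = v i \<bullet> c + u * D" "x \<bullet> c = v (Suc i) \<bullet> c - (1 - u) * D"
    by (simp_all add: u(3) D_def inner_add_left algebra_simps)
  show "v i \<bullet> c \<le> x \<bullet> c" "x \<bullet> c \<le> v (Suc i) \<bullet> c"
    using * D u(1,2) mult_nonneg_nonneg[of u D] mult_nonneg_nonneg[of "1 - u" D] by linarith+
  show "x = v i" if "x \<bullet> c = v i \<bullet> c"
    using that *(1) D u(3) by simp
  show "x = v (Suc i)" if "x \<bullet> c = v (Suc i) \<bullet> c"
    using that *(2) D u(3) by simp
qed

lemma vertex_mem: "j \<le> n \<Longrightarrow> v j \<in> P"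
proof -
  assume "j \<le> n"
  have "closed_segment (v i) (v (Suc i)) \<subseteq> P" if "i < n" for i
    using edge[OF that] by (auto simp: support_face_def)
  then have "v i \<in> P" if "i < n" for i using that ends_in_segment(1) by blast
  moreover have "v n \<in> P" using greatest by (auto simp: support_face_def)
  ultimately show ?thesis using \<open>j \<le> n\<close> by (cases "j = n") auto
qed

lemma edge_max:
  assumes "i < n" "y \<in> P"
  shows "y \<bullet> (\<omega> - s i *\<^sub>R c) \<le> v i \<bullet> (\<omega> - s i *\<^sub>R c)"
    "y \<bullet> (\<omega> - s i *\<^sub>R c) \<le> v (Suc i) \<bullet> (\<omega> - s i *\<^sub>R c)"
  using edge[OF assms(1)] assms(2) ends_in_segment[of "v i" "v (Suc i)"]
  by (auto simp: support_face_def set_eq_iff)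

lemma edge_max_eq:
  assumes "i < n" "y \<in> P" "j = i \<or> j = Suc i"
    "y \<bullet> (\<omega> - s i *\<^sub>R c) = v j \<bullet> (\<omega> - s i *\<^sub>R c)"
  shows "y \<in> closed_segment (v i) (v (Suc i))"
proof -
  have "y \<in> support_face P (\<omega> - s i *\<^sub>R c)"
    using assms edge_max[OF assms(1)] by (auto simp: support_face_def)
  then show ?thesis using edge assms(1) by simp
qed

text \<open>Replacing the slope of an adjacent edge by \<open>t\<close> adds a multiple of the
  height to the functional. Points at least as high as \<open>v j\<close> are compared through the
  outgoing edge, lower ones through the incoming edge. At a different height the tilt favours
  \<open>v j\<close>; at equal height the outgoing edge already decides.\<close>

lemma support_vertex:
  assumes j: "j \<le> n" and lo: "j < n \<Longrightarrow> s j < t" and hi: "0 < j \<Longrightarrow> t < s (j - 1)"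
  shows "support_face P (\<omega> - t *\<^sub>R c) = {v j}"
proof -
  have *: "y \<bullet> (\<omega> - t *\<^sub>R c) < v j \<bullet> (\<omega> - t *\<^sub>R c)" if y: "y \<in> P" "y \<noteq> v j" for y
  proof (cases "y \<bullet> c \<ge> v j \<bullet> c")
    case True
    \<comment> \<open>Otherwise \<open>v j\<close> is the top vertex, and \<open>y\<close> would be
      a second point of the top face.\<close>
    have "j < n"
    proof (rule ccontr)
      assume "\<not> j < n"
      then have "\<forall>z\<in>P. z \<bullet> c \<le> v j \<bullet> c"
        using j greatest by (auto simp: support_face_def)
      then have "y \<in> support_face P c"
        using True y(1) by (auto simp: support_face_def intro: order_trans)
      then show False using greatest y \<open>\<not> j < n\<close> j by simp
    qed
    then have t: "s j < t" using lo by simp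
    have e: "x \<bullet> (\<omega> - t *\<^sub>R c) = x \<bullet> (\<omega> - s j *\<^sub>R c) - (t - s j) * (x \<bullet> c)" for x
      by (simp add: inner_diff_right algebra_simps)
    show ?thesis
    proof (cases "y \<bullet> c = v j \<bullet> c")
      case True
      then have "y \<notin> closed_segment (v j) (v (Suc j))"
        using segment_height(3) \<open>j < n\<close> y(2) by blast
      then have "y \<bullet> (\<omega> - s j *\<^sub>R c) < v j \<bullet> (\<omega> - s j *\<^sub>R c)"
        using edge_max(1)[OF \<open>j < n\<close> y(1)] edge_max_eq[OF \<open>j < n\<close> y(1), of j] by fastforce
      then show ?thesis using True by (simp add: e)
    next
      case False
      then have "(t - s j) * (v j \<bullet> c) < (t - s j) * (y \<bullet> c)"
        using True t by simp
      then show ?thesis using edge_max(1)[OF \<open>j < n\<close> y(1)] by (simp add: e)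
    qed
  next
    case False
    have "0 < j"
    proof (rule ccontr)
      assume "\<not> 0 < j"
      then have "v j \<in> support_face P (- c)" using least by simp
      then show False using y(1) False by (auto simp: support_face_def)
    qed
    then obtain i where i: "j = Suc i" "i < n" using j by (metis Suc_le_eq gr0_implies_Suc)
    then have t: "t < s i" using hi by simp
    have e: "x \<bullet> (\<omega> - t *\<^sub>R c) = x \<bullet> (\<omega> - s i *\<^sub>R c) + (s i - t) * (x \<bullet> c)" for x
      by (simp add: inner_diff_right algebra_simps)
    have "(s i - t) * (y \<bullet> c) < (s i - t) * (v j \<bullet> c)"
      using False t by simp
    then show ?thesis using edge_max(2)[OF i(2) y(1)] i by (simp add: e)
  qed
  show ?thesis
    by (rule support_face_eqI[where M = "v j \<bullet> (\<omega> - t *\<^sub>R c)"])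
      (use * vertex_mem[OF j] in \<open>force+\<close>)
qed

lemma slope_exists:
  assumes "j \<le> n"
  shows "\<exists>t. (j < n \<longrightarrow> s j < t) \<and> (0 < j \<longrightarrow> t < s (j - 1))"
proof (cases "0 < j \<and> j < n")
  case True
  then obtain i where "j = Suc i" by (auto simp: gr0_conv_Suc)
  then show ?thesis using dense[OF dec[of i]] True by auto
next
  case False
  then show ?thesis
    using assms lt_ex[of "s (j - 1)"] gt_ex[of "s j"] by auto
qed

text \<open>The first edge with slope at most \<open>t\<close> decides: equality gives that edge, a
  smaller slope puts \<open>t\<close> into the gap of the vertex where the edge starts. If no slope
  is that small, \<open>t\<close> belongs to \<open>v n\<close>.\<close>

lemma slope_cases:
  obtains i where "i < n" "t = s i"
  | j where "j \<le> n" "j < n \<Longrightarrow> s j < t" "0 < j \<Longrightarrow> t < s (j - 1)"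
proof (cases "\<exists>i<n. s i \<le> t")
  case True
  define j where "j = (LEAST i. i < n \<and> s i \<le> t)"
  have j: "j < n" "s j \<le> t" using LeastI_ex[OF True] by (auto simp: j_def)
  have "t < s (j - 1)" if "0 < j"
    using not_less_Least[of "j - 1" "\<lambda>i. i < n \<and> s i \<le> t"] that j(1)
    unfolding j_def[symmetric] by auto
  then show ?thesis using that(1)[of j] that(2)[of j] j by fastforce
next
  case False
  then show ?thesis using that(2)[of n] pos by (auto simp: not_le)
qed

text \<open>As \<open>t\<close> sweeps the reals only vertices and edges of the path are met, so
  nothing else can appear on the upper boundary of the polygon.\<close>

lemma support_cases:
  obtains i where "i < n" "support_face P (\<omega> - t *\<^sub>R c) = closed_segment (v i) (v (Suc i))"
  | j where "j \<le> n" "support_face P (\<omega> - t *\<^sub>R c) = {v j}"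
proof (cases rule: slope_cases[of t])
  case (1 i)
  then show ?thesis using that(1) edge by blast
next
  case (2 j)
  then show ?thesis using that(2) support_vertex by blast
qed

lemma support_vertex_exists:
  assumes "j \<le> n" obtains t where "support_face P (\<omega> - t *\<^sub>R c) = {v j}"
  using slope_exists[OF assms] support_vertex[OF assms] by blast

lemma vertex_extreme: "j \<le> n \<Longrightarrow> v j extreme_point_of P"
  by (metis support_vertex_exists support_face_face_of[OF convex] face_of_singleton)

lemma height_less: "i < j \<Longrightarrow> j \<le> n \<Longrightarrow> v i \<bullet> c < v j \<bullet> c"
proof (induction j)
  case (Suc j)
  then show ?case using inc[of j] by (cases "i = j") auto
qed simp

text \<open>Increasing heights make the \<open>n + 1\<close> path vertices distinct. This places the
  length \<open>n\<close> inside the range of \<open>length_sequence\<close>.\<close>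

lemma card_extreme_points:
  assumes "finite {x. x extreme_point_of P}"
  shows "n < card {x. x extreme_point_of P}"
proof -
  have "inj_on v {..n}"
    using height_less by (intro linorder_inj_onI) (auto, metis less_irrefl)
  then have "card (v ` {..n}) = Suc n" by (simp add: card_image)
  moreover have "v ` {..n} \<subseteq> {x. x extreme_point_of P}" using vertex_extreme by auto
  then have "card (v ` {..n}) \<le> card {x. x extreme_point_of P}" by (rule card_mono[OF assms])
  ultimately show ?thesis by linarith
qed

lemma monotone_path: "monotone_path P c (map v [0..<Suc n])"
proof -
  have "min_vertex P c (v 0)" "max_vertex P c (v n)"
    using vertex_extreme[of 0] vertex_extreme[of n] least greatest
    by (auto simp: min_vertex_def max_vertex_def support_face_def set_eq_iff)
  moreover have "monotone_arc P c (v i) (v (Suc i))" if "i < n" for i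
  proof -
    have "closed_segment (v i) (v (Suc i)) face_of P"
      using support_face_face_of[OF convex, of "\<omega> - s i *\<^sub>R c"] edge[OF that] by simp
    moreover have "v i \<noteq> v (Suc i)" using inc[OF that] by auto
    ultimately show ?thesis
      unfolding monotone_arc_def edge_of_def
      using that vertex_extreme inc[OF that] by (simp add: aff_dim_closed_segment)
  qed
  ultimately show ?thesis
    unfolding monotone_path_def successively_conv_nth
    by (auto simp: hd_map last_map nth_append simp del: upt_Suc)
qed

section \<open>Projection to the plane and upper faces of the polygon\<close>

lemma plane_proj_linear: "linear (plane_proj c \<omega>)"
  by (rule linearI) (auto simp: plane_proj_def inner_add_left)

text \<open>Every normal with positive second coordinate is a positive multiple of some
  \<open>(- t, 1)\<close>. Hence upper faces of the polygon are governed by the functionals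
  \<open>\<omega> - t *\<^sub>R c\<close> on \<open>P\<close>.\<close>

lemma plane_proj_normal: "plane_proj c \<omega> x \<bullet> (- t, 1) = x \<bullet> (\<omega> - t *\<^sub>R c)"
  by (simp add: plane_proj_def inner_diff_right inner_prod_def)

lemma support_face_image:
  "support_face (plane_proj c \<omega> ` P) (- t, 1) = plane_proj c \<omega> ` support_face P (\<omega> - t *\<^sub>R c)"
  by (auto simp: support_face_def plane_proj_normal)

text \<open>Being a maximiser depends only on the projection of the point, so these faces are full
  preimages, as the definition of coherence requires.\<close>

lemma support_face_vimage:
  assumes "x \<in> P" "plane_proj c \<omega> x \<in> plane_proj c \<omega> ` support_face P (\<omega> - t *\<^sub>R c)"
  shows "x \<in> support_face P (\<omega> - t *\<^sub>R c)"
  using assms by (auto simp: support_face_image[symmetric]) (auto simp: support_face_def plane_proj_normal)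

lemma upper_face_support:
  assumes "aff_dim (plane_proj c \<omega> ` support_face P (\<omega> - t *\<^sub>R c)) \<in> {0, 1}"
  shows "upper_face (plane_proj c \<omega> ` P) (plane_proj c \<omega> ` support_face P (\<omega> - t *\<^sub>R c))"
proof -
  have "convex (plane_proj c \<omega> ` P)"
    using convex_linear_image plane_proj_linear convex by blast
  then have "plane_proj c \<omega> ` support_face P (\<omega> - t *\<^sub>R c) face_of plane_proj c \<omega> ` P"
    using support_face_face_of support_face_image by metis
  moreover have "\<forall>y\<in>plane_proj c \<omega> ` support_face P (\<omega> - t *\<^sub>R c).
      \<forall>z\<in>plane_proj c \<omega> ` P. z \<bullet> (- t, 1) \<le> y \<bullet> (- t, 1)"
    by (auto simp: support_face_def plane_proj_normal)
  ultimately show ?thesis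
    unfolding upper_face_def using assms
    by (intro conjI exI[of _ "(- t, 1)"]) auto
qed

lemma support_cell:
  assumes "aff_dim (plane_proj c \<omega> ` support_face P (\<omega> - t *\<^sub>R c)) \<in> {0, 1}"
  shows "support_face P (\<omega> - t *\<^sub>R c) \<in>
    {{x \<in> P. plane_proj c \<omega> x \<in> F} | F. upper_face (plane_proj c \<omega> ` P) F}"
proof -
  have "support_face P (\<omega> - t *\<^sub>R c) =
      {x \<in> P. plane_proj c \<omega> x \<in> plane_proj c \<omega> ` support_face P (\<omega> - t *\<^sub>R c)}"
    using support_face_vimage by (auto simp: support_face_def)
  then show ?thesis using upper_face_support[OF assms] by blast
qed

lemma path_cells_eq:
  "path_cells (map v [0..<Suc n]) =
     {{v j} | j. j \<le> n} \<union> {closed_segment (v i) (v (Suc i)) | i. i < n}"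
proof -
  have "map v [0..<Suc n] ! i = v i" if "i \<le> n" for i
    using that nth_map_upt[of i "Suc n" 0 v] by simp
  then have "closed_segment (map v [0..<Suc n] ! i) (map v [0..<Suc n] ! Suc i) =
      closed_segment (v i) (v (Suc i))" if "i < n" for i
    using that by (metis Suc_leI less_imp_le)
  moreover have "set (map v [0..<Suc n]) = v ` {..n}"
    by (auto simp: less_Suc_eq_le simp del: upt_Suc)
  moreover have "Suc i < length (map v [0..<Suc n]) \<longleftrightarrow> i < n" for i by simp
  ultimately show ?thesis
    unfolding path_cells_def by (intro arg_cong2[where f = "(\<union>)"] Collect_cong) (blast, metis)
qed

text \<open>An upper face lies in the projection of a support face, which is a vertex or an edge of
  the path. It is thus a face of a point or of a segment, and its preimage can be listed.\<close>

lemma upper_face_cell: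
  assumes F: "upper_face (plane_proj c \<omega> ` P) F"
  shows "{x \<in> P. plane_proj c \<omega> x \<in> F} \<in> path_cells (map v [0..<Suc n])"
proof -
  let ?\<pi> = "plane_proj c \<omega>"
  obtain N where N: "snd N > 0" "\<forall>y\<in>F. \<forall>z\<in>?\<pi> ` P. z \<bullet> N \<le> y \<bullet> N"
    using F unfolding upper_face_def by blast
  have face: "F face_of ?\<pi> ` P" and ne: "F \<noteq> {}"
    using F by (auto simp: upper_face_def)
  \<comment> \<open>Scaling \<open>N\<close> to second coordinate 1 turns it into
    \<open>(- t, 1)\<close>.\<close>
  define t where "t = - fst N / snd N"
  have dot: "y \<bullet> N = snd N * (y \<bullet> (- t, 1))" for y
    using N(1) by (cases y; cases N) (simp add: t_def field_simps)
  have dom: "z \<bullet> (- t, 1) \<le> y \<bullet> (- t, 1)" if "y \<in> F" "z \<in> ?\<pi> ` P" for y z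
  proof -
    have "snd N * (z \<bullet> (- t, 1)) \<le> snd N * (y \<bullet> (- t, 1))"
      using N(2) that by (simp only: dot)
    then show ?thesis using N(1) by simp
  qed
  have "y \<in> support_face (?\<pi> ` P) (- t, 1)" if "y \<in> F" for y
    using face_of_imp_subset[OF face] dom[OF that] that unfolding support_face_def by blast
  then have sub: "F \<subseteq> ?\<pi> ` support_face P (\<omega> - t *\<^sub>R c)"
    unfolding support_face_image by blast
  \<comment> \<open>All points of \<open>P\<close> above \<open>F\<close> lie in the support face,
    so the preimage can be computed there.\<close>
  have cell: "{x \<in> P. ?\<pi> x \<in> F} = {x \<in> support_face P (\<omega> - t *\<^sub>R c). ?\<pi> x \<in> F}"
    using sub support_face_vimage by (auto simp: support_face_def)
  show ?thesis
  proof (cases rule: support_cases[of t])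
    case (2 j)
    then have "F = {?\<pi> (v j)}" using sub ne by auto
    then have "{x \<in> P. ?\<pi> x \<in> F} = {v j}" using cell 2 by auto
    then show ?thesis using 2 path_cells_eq by auto
  next
    case (1 i)
    have im: "?\<pi> ` closed_segment (v i) (v (Suc i)) = closed_segment (?\<pi> (v i)) (?\<pi> (v (Suc i)))"
      using closed_segment_linear_image plane_proj_linear by metis
    \<comment> \<open>A face of the polygon contained in the projected edge is also a face of that
      edge.\<close>
    have "F face_of closed_segment (?\<pi> (v i)) (?\<pi> (v (Suc i)))"
      using face_of_subset[OF face] sub 1 im face_of_imp_subset[OF support_face_face_of[OF convex]]
      by (metis image_mono)
    then consider "F = {?\<pi> (v i)}" | "F = {?\<pi> (v (Suc i))}"
      | "F = ?\<pi> ` closed_segment (v i) (v (Suc i))"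
      using face_of_closed_segment_cases ne im by metis
    then show ?thesis
    proof cases
      case A: 1
      then have "{x \<in> P. ?\<pi> x \<in> F} = {v i}"
        using cell 1 segment_height(3)[OF 1(1)] by (auto simp: plane_proj_def)
      then show ?thesis using 1 path_cells_eq by auto
    next
      case A: 2
      then have "{x \<in> P. ?\<pi> x \<in> F} = {v (Suc i)}"
        using cell 1 segment_height(4)[OF 1(1)] by (auto simp: plane_proj_def)
      then show ?thesis using 1 path_cells_eq by auto
    next
      case A: 3
      then have "{x \<in> P. ?\<pi> x \<in> F} = closed_segment (v i) (v (Suc i))"
        using cell 1 by auto
      then show ?thesis using 1 path_cells_eq by auto
    qed
  qed
qed

lemma coherent:
  assumes "c \<noteq> \<omega>" "independent {c, \<omega>}"
  shows "coherent P c (map v [0..<Suc n])"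
proof -
  let ?\<pi> = "plane_proj c \<omega>"
  let ?C = "{{x \<in> P. ?\<pi> x \<in> F} | F. upper_face (?\<pi> ` P) F}"
  have "{v j} \<in> ?C" if j: "j \<le> n" for j
  proof -
    obtain t where t: "support_face P (\<omega> - t *\<^sub>R c) = {v j}"
      using support_vertex_exists[OF j] by blast
    show ?thesis using support_cell[of t] t by simp
  qed
  moreover have "closed_segment (v i) (v (Suc i)) \<in> ?C" if i: "i < n" for i
  proof -
    have "?\<pi> ` closed_segment (v i) (v (Suc i)) = closed_segment (?\<pi> (v i)) (?\<pi> (v (Suc i)))"
      using closed_segment_linear_image plane_proj_linear by metis
    moreover have "?\<pi> (v i) \<noteq> ?\<pi> (v (Suc i))"
      using inc[OF i] by (auto simp: plane_proj_def)
    ultimately have "aff_dim (?\<pi> ` support_face P (\<omega> - s i *\<^sub>R c)) \<in> {0, 1}"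
      by (simp add: aff_dim_closed_segment edge[OF i])
    from support_cell[OF this] show ?thesis unfolding edge[OF i] .
  qed
  ultimately have "path_cells (map v [0..<Suc n]) \<subseteq> ?C"
    unfolding path_cells_eq by blast
  moreover have "?C \<subseteq> path_cells (map v [0..<Suc n])"
    using upper_face_cell by auto
  ultimately show ?thesis unfolding coherent_def using assms by blast
qed

end

section \<open>Projective maps and the unit cube\<close>

text \<open>Faces and convexity are expressed through open segments alone, so an injection carrying
  open segments onto open segments transports faces even if it is not affine.\<close>

lemma image_face_of:
  assumes "T face_of S"
    and seg: "\<And>x y. x \<in> S \<Longrightarrow> y \<in> S \<Longrightarrow> f ` open_segment x y = open_segment (f x) (f y)"
    and inj: "inj_on f S" and "convex S"
  shows "f ` T face_of f ` S"
proof -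
  have sub: "T \<subseteq> S" and conv: "convex T"
    using assms(1) face_of_imp_subset face_of_imp_convex by auto
  have "open_segment (f x) (f y) \<subseteq> f ` T" if "x \<in> T" "y \<in> T" for x y
    using seg[of x y] that sub conv
    by (metis (no_types) convex_contains_open_segment image_mono subsetD)
  then have "convex (f ` T)"
    by (auto simp: convex_contains_open_segment)
  moreover have "a \<in> T \<and> b \<in> T"
    if ab: "a \<in> S" "b \<in> S" and x: "x \<in> T" "f x \<in> open_segment (f a) (f b)" for a b x
  proof -
    obtain z where z: "z \<in> open_segment a b" "f z = f x"
      using seg[OF ab] x(2) by (metis imageE)
    then have "z \<in> S"
      using \<open>convex S\<close> ab by (meson convex_contains_open_segment subsetD)
    then have "z = x" using inj z(2) x(1) sub by (metis inj_onD subsetD)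
    then show ?thesis using face_ofD[OF assms(1) z(1)] ab x(1) by blast
  qed
  ultimately show ?thesis using sub unfolding face_of_def by blast
qed

text \<open>The denominator is affine, so dividing by it only reweights the convex combination: with
  denominators \<open>p\<close>, \<open>q\<close>, \<open>r\<close> at \<open>x\<close>,
  \<open>y\<close>, \<open>z\<close> the new weights \<open>(1 - u) * p / r\<close> and
  \<open>u * q / r\<close> are positive and sum to 1.\<close>

lemma projective_open_segment:
  fixes x y z a :: "'a::real_inner" and k :: real
  assumes "k + a \<bullet> x > 0" "k + a \<bullet> y > 0" "z \<in> open_segment x y"
    and ne: "(1 / (k + a \<bullet> x)) *\<^sub>R x \<noteq> (1 / (k + a \<bullet> y)) *\<^sub>R y"
  shows "(1 / (k + a \<bullet> z)) *\<^sub>R z \<in>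
    open_segment ((1 / (k + a \<bullet> x)) *\<^sub>R x) ((1 / (k + a \<bullet> y)) *\<^sub>R y)"
proof -
  obtain u where u: "0 < u" "u < 1" "z = (1 - u) *\<^sub>R x + u *\<^sub>R y"
    using assms(3) by (auto simp: in_segment)
  define p q where "p = k + a \<bullet> x" and "q = k + a \<bullet> y"
  have pq: "p > 0" "q > 0" using assms by (simp_all add: p_def q_def)
  define r where "r = (1 - u) * p + u * q"
  have r: "k + a \<bullet> z = r"
    by (simp add: r_def u(3) p_def q_def inner_add_right algebra_simps)
  have "(1 - u) * p > 0" "u * q > 0" using pq u by simp_all
  then have rpos: "r > 0" by (simp add: r_def)
  define \<mu> where "\<mu> = u * q / r"
  have \<mu>: "0 < \<mu>" "\<mu> < 1"
    using \<open>(1 - u) * p > 0\<close> \<open>u * q > 0\<close> rpos by (simp_all add: \<mu>_def r_def)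
  have "1 - \<mu> = (1 - u) * p / r"
    using rpos by (simp add: \<mu>_def field_simps r_def)
  then have "(1 - \<mu>) *\<^sub>R (1 / p) *\<^sub>R x + \<mu> *\<^sub>R (1 / q) *\<^sub>R y = (1 / r) *\<^sub>R z"
    using pq by (simp add: \<mu>_def u(3) scaleR_add_right)
  then show ?thesis
    using ne \<mu> unfolding in_segment r p_def q_def by metis
qed

text \<open>A coordinate strictly between 0 and 1 can be moved both ways by its distance
  \<open>e\<close> to the nearer bound, making \<open>v\<close> a midpoint within the cube.\<close>

lemma extreme_point_of_unit_cube:
  fixes v :: "real ^ 'n"
  assumes "v extreme_point_of cbox 0 1"
  shows "v $ i = 0 \<or> v $ i = 1"
proof (rule ccontr)
  assume neg: "\<not> (v $ i = 0 \<or> v $ i = 1)"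
  have v: "0 \<le> v $ j" "v $ j \<le> 1" for j
    using assms by (auto simp: extreme_point_of_def mem_box_cart)
  define e where "e = min (v $ i) (1 - v $ i)"
  have e: "0 < e" "e \<le> v $ i" "e \<le> 1 - v $ i"
    using neg v[of i] by (auto simp: e_def)
  have "v + axis i e \<in> cbox 0 1" "v - axis i e \<in> cbox 0 1"
    using v e by (auto simp: mem_box_cart axis_def)
  moreover have "axis i e \<noteq> (0 :: real ^ 'n)"
    using e by (simp add: axis_eq_0_iff)
  then have "v \<in> open_segment (v - axis i e) (v + axis i e)"
    using midpoint_in_open_segment[of "v - axis i e" "v + axis i e"]
    by (simp add: midpoint_def algebra_simps flip: scaleR_2)
  ultimately show False using assms by (auto simp: extreme_point_of_def)
qed

text \<open>If the ends differed in coordinates \<open>i\<close> and \<open>j\<close>, the midpoint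
  \<open>m\<close> would have value 1/2 in both. Moving \<open>m\<close> along \<open>i\<close>
  alone stays in the cube, so the face property puts the moved point on the segment. Its unchanged
  coordinate \<open>j\<close> forces parameter 1/2, which is \<open>m\<close> itself.\<close>

lemma edge_of_unit_cube:
  fixes u v :: "real ^ 'n"
  assumes face: "closed_segment u v face_of cbox 0 1" and "u \<noteq> v"
    and u: "u extreme_point_of cbox 0 1" and v: "v extreme_point_of cbox 0 1"
  shows "\<exists>i. u $ i \<noteq> v $ i \<and> (\<forall>j. j \<noteq> i \<longrightarrow> u $ j = v $ j)"
proof (rule ccontr)
  assume "\<not> ?thesis"
  moreover obtain i where i: "u $ i \<noteq> v $ i" using \<open>u \<noteq> v\<close> by (auto simp: vec_eq_iff)
  ultimately obtain j where j: "j \<noteq> i" "u $ j \<noteq> v $ j" by blast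
  define m where "m = midpoint u v"
  have half: "m $ l = 1 / 2" if "u $ l \<noteq> v $ l" for l
    using extreme_point_of_unit_cube[OF u, of l] extreme_point_of_unit_cube[OF v, of l] that
    by (auto simp: m_def midpoint_def)
  have m: "0 \<le> m $ l" "m $ l \<le> 1" for l
    using extreme_point_of_unit_cube[OF u, of l] extreme_point_of_unit_cube[OF v, of l]
    by (auto simp: m_def midpoint_def)
  let ?e = "axis i (1 / 2) :: real ^ 'n"
  have "m - ?e \<in> cbox 0 1" "m + ?e \<in> cbox 0 1"
    using m half[OF i] by (auto simp: mem_box_cart axis_def)
  moreover have "?e \<noteq> 0" by (simp add: axis_eq_0_iff)
  then have "m \<in> open_segment (m - ?e) (m + ?e)"
    using midpoint_in_open_segment[of "m - ?e" "m + ?e"]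
    by (simp add: midpoint_def algebra_simps flip: scaleR_2)
  moreover have "m \<in> closed_segment u v" by (simp add: m_def)
  ultimately have "m + ?e \<in> closed_segment u v"
    using face_ofD[OF face] by blast
  then obtain t where t: "m + ?e = (1 - t) *\<^sub>R u + t *\<^sub>R v" by (auto simp: in_segment)
  have "(1 - t) * u $ j + t * v $ j = 1 / 2"
    using arg_cong[OF t, of "\<lambda>x. x $ j"] half[OF j(2)] j(1) by (simp add: axis_def)
  then have "t = 1 / 2"
    using extreme_point_of_unit_cube[OF u, of j] extreme_point_of_unit_cube[OF v, of j] j(2) by auto
  have "m + ?e = m" unfolding t \<open>t = 1 / 2\<close> by (simp add: m_def midpoint_def scaleR_add_right)
  then show False using \<open>?e \<noteq> 0\<close> by simp
qed

text \<open>Its parity is a proper 2-colouring of the graph of the cube.\<close>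

definition nonzero_count :: "real ^ 'n \<Rightarrow> nat" where
  "nonzero_count x = card {i. x $ i \<noteq> 0}"

lemma odd_nonzero_count_unit_cube_edge:
  fixes u v :: "real ^ 'n"
  assumes "closed_segment u v face_of cbox 0 1" "u \<noteq> v"
    and u: "u extreme_point_of cbox 0 1" and v: "v extreme_point_of cbox 0 1"
  shows "odd (nonzero_count u + nonzero_count v)"
proof -
  have *: "odd (nonzero_count x + nonzero_count y)"
    if "x $ i = 0" "y $ i \<noteq> 0" "\<And>j. j \<noteq> i \<Longrightarrow> x $ j = y $ j" for x y :: "real ^ 'n" and i
  proof -
    have "{j. y $ j \<noteq> 0} = insert i {j. x $ j \<noteq> 0}" using that by (auto, metis)
    then show ?thesis using that(1) by (simp add: nonzero_count_def)
  qed
  obtain i where i: "u $ i \<noteq> v $ i" "\<And>j. j \<noteq> i \<Longrightarrow> u $ j = v $ j"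
    using edge_of_unit_cube[OF assms] by blast
  then consider "u $ i = 0" | "v $ i = 0"
    using extreme_point_of_unit_cube[OF u, of i] extreme_point_of_unit_cube[OF v, of i] by metis
  then show ?thesis
  proof cases
    case 1 then show ?thesis using *[of u i v] i by simp
  next
    case 2 then show ?thesis using *[of v i u] i by (simp add: add.commute)
  qed
qed

text \<open>Each step flips the parity of \<open>N\<close>, so the colours of the two ends fix the
  parity of the number of steps.\<close>

lemma even_path_length:
  assumes "successively (\<lambda>u v. odd (N u + N v)) p" "p \<noteq> []"
  shows "even (N (hd p) + N (last p) + path_length p)"
  using assms
proof (induction p rule: induct_list012)
  case (3 x y zs)
  then have "odd (N x + N y)" "even (N y + N (last (y # zs)) + path_length (y # zs))" by auto
  then show ?case by (auto simp: path_length_def)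
qed (auto simp: path_length_def)

text \<open>The strict descent at \<open>i\<close> forces the peak index \<open>k\<close> to be at
  most \<open>i\<close>, which rules out the later ascent.\<close>

lemma not_unimodal_if_dip:
  assumes "Suc (Suc i) < length a" "a ! i > a ! Suc i" "a ! Suc i < a ! Suc (Suc i)"
  shows "\<not> unimodal a"
proof
  assume "unimodal a"
  then obtain k where k: "\<And>i. Suc i < length a \<Longrightarrow>
      (i < k \<longrightarrow> a ! i \<le> a ! Suc i) \<and> (k \<le> i \<longrightarrow> a ! i \<ge> a ! Suc i)"
    by (auto simp: unimodal_def)
  show False using k[of i] k[of "Suc i"] assms by (cases "i < k") auto
qed

section \<open>The frustum\<close>

definition frustum :: "'n \<Rightarrow> (real ^ 'n) set" where
  "frustum k = {x. 0 \<le> x $ k \<and> x $ k \<le> 1 \<and> (\<forall>j. j \<noteq> k \<longrightarrow> 0 \<le> x $ j \<and> x $ j \<le> 2 - x $ k)}"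

definition cube_to_frustum :: "'n \<Rightarrow> real ^ 'n \<Rightarrow> real ^ 'n" where
  "cube_to_frustum k x = (1 / (1 / 2 + axis k (1 / 2) \<bullet> x)) *\<^sub>R x"

text \<open>The inverse map: for \<open>y = 2 x / (1 + x $ k)\<close> one has
  \<open>2 - y $ k = 2 / (1 + x $ k)\<close>, so \<open>y / (2 - y $ k)\<close> is \<open>x\<close>.
  Both maps are written with a denominator of the form constant plus inner product, the shape in
  \<open>projective_open_segment\<close>.\<close>

definition frustum_to_cube :: "'n \<Rightarrow> real ^ 'n \<Rightarrow> real ^ 'n" where
  "frustum_to_cube k x = (1 / (2 + axis k (- 1) \<bullet> x)) *\<^sub>R x"

lemma cube_to_frustum_nth: "cube_to_frustum k x $ j = 2 * x $ j / (1 + x $ k)"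
  by (simp add: cube_to_frustum_def inner_axis' divide_simps)

lemma frustum_to_cube_nth: "frustum_to_cube k x $ j = x $ j / (2 - x $ k)"
  by (simp add: frustum_to_cube_def inner_axis' divide_simps)

lemma convex_frustum:
  fixes k :: "'n::finite"
  shows "convex (frustum k)"
proof (rule convexI)
  fix x y :: "real ^ 'n" and u v :: real
  assume xy: "x \<in> frustum k" "y \<in> frustum k" and uv: "0 \<le> u" "0 \<le> v" "u + v = 1"
  have le: "u * a + v * b \<le> u * a' + v * b'" if "a \<le> a'" "b \<le> b'" for a b a' b' :: real
    using uv that by (intro add_mono mult_left_mono) auto
  have "u * x $ j + v * y $ j \<le> 2 - (u * x $ k + v * y $ k)" if "j \<noteq> k" for j
  proof -
    have "u * x $ j + v * y $ j \<le> u * (2 - x $ k) + v * (2 - y $ k)"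
      using xy that by (intro le) (auto simp: frustum_def)
    also have "\<dots> = 2 * (u + v) - (u * x $ k + v * y $ k)"
      by (simp add: algebra_simps)
    finally show ?thesis using uv by simp
  qed
  moreover have "u * x $ k + v * y $ k \<le> 1"
    using le[of "x $ k" 1 "y $ k" 1] xy uv by (auto simp: frustum_def)
  ultimately show "u *\<^sub>R x + v *\<^sub>R y \<in> frustum k"
    using xy uv by (auto simp: frustum_def)
qed

section \<open>Mutually inverse maps between cube and frustum\<close>

lemma cube_to_frustum_mem:
  assumes "x \<in> cbox 0 1"
  shows "cube_to_frustum k x \<in> frustum k"
proof -
  have x: "0 \<le> x $ j" "x $ j \<le> 1" for j using assms by (auto simp: mem_box_cart)
  have "2 - 2 * x $ k / (1 + x $ k) = 2 / (1 + x $ k)"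
    using x(1)[of k] by (simp add: field_simps)
  moreover have "2 * x $ k / (1 + x $ k) \<le> 1"
    using x[of k] by (simp add: divide_le_eq)
  ultimately show ?thesis
    using x by (auto simp: frustum_def cube_to_frustum_nth divide_right_mono)
qed

lemma frustum_to_cube_mem:
  assumes "x \<in> frustum k"
  shows "frustum_to_cube k x \<in> cbox 0 1"
proof -
  \<comment> \<open>For \<open>j = k\<close> the upper bound says
    \<open>x $ k \<le> 2 - x $ k\<close>, which is \<open>x $ k \<le> 1\<close>.\<close>
  have "0 \<le> x $ j \<and> x $ j \<le> 2 - x $ k" "2 - x $ k > 0" for j
    using assms by (cases "j = k"; force simp: frustum_def)+
  then show ?thesis by (auto simp: mem_box_cart frustum_to_cube_nth)
qed

lemma frustum_to_cube_to_frustum: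
  assumes "x \<in> frustum k"
  shows "cube_to_frustum k (frustum_to_cube k x) = x"
proof -
  have "2 - x $ k > 0" using assms by (auto simp: frustum_def)
  moreover from this have "1 + x $ k / (2 - x $ k) = 2 / (2 - x $ k)" by (simp add: field_simps)
  ultimately show ?thesis by (simp add: vec_eq_iff cube_to_frustum_nth frustum_to_cube_nth)
qed

lemma cube_to_frustum_to_cube:
  assumes "x \<in> cbox 0 1"
  shows "frustum_to_cube k (cube_to_frustum k x) = x"
proof -
  have "1 + x $ k > 0" using assms by (auto simp: mem_box_cart add_pos_nonneg)
  moreover from this have "2 - 2 * x $ k / (1 + x $ k) = 2 / (1 + x $ k)" by (simp add: field_simps)
  ultimately show ?thesis by (simp add: vec_eq_iff cube_to_frustum_nth frustum_to_cube_nth)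
qed

lemma inj_on_cube_to_frustum: "inj_on (cube_to_frustum k) (cbox 0 1)"
  by (metis cube_to_frustum_to_cube inj_onI)

lemma inj_on_frustum_to_cube: "inj_on (frustum_to_cube k) (frustum k)"
  by (metis frustum_to_cube_to_frustum inj_onI)

lemma cube_to_frustum_image: "cube_to_frustum k ` cbox 0 1 = frustum k"
  using cube_to_frustum_mem frustum_to_cube_mem frustum_to_cube_to_frustum
  by (metis image_eqI subsetI subset_antisym image_subsetI)

lemma frustum_to_cube_image: "frustum_to_cube k ` frustum k = cbox 0 1"
  using cube_to_frustum_mem frustum_to_cube_mem cube_to_frustum_to_cube
  by (metis image_eqI subsetI subset_antisym image_subsetI)

section \<open>Segments and faces under the two maps\<close>

lemma cube_to_frustum_open_segment_subset:
  assumes "x \<in> cbox 0 1" "y \<in> cbox 0 1"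
  shows "cube_to_frustum k ` open_segment x y \<subseteq>
    open_segment (cube_to_frustum k x) (cube_to_frustum k y)"
proof (cases "x = y")
  case False
  then have "cube_to_frustum k x \<noteq> cube_to_frustum k y"
    using assms inj_onD[OF inj_on_cube_to_frustum] by blast
  moreover have "1 / 2 + axis k (1 / 2) \<bullet> x > 0" "1 / 2 + axis k (1 / 2) \<bullet> y > 0"
    using assms by (auto simp: inner_axis' mem_box_cart add_pos_nonneg)
  ultimately show ?thesis
    unfolding cube_to_frustum_def using projective_open_segment by blast
qed simp

lemma frustum_to_cube_open_segment_subset:
  assumes "x \<in> frustum k" "y \<in> frustum k"
  shows "frustum_to_cube k ` open_segment x y \<subseteq>
    open_segment (frustum_to_cube k x) (frustum_to_cube k y)"
proof (cases "x = y")
  case False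
  then have "frustum_to_cube k x \<noteq> frustum_to_cube k y"
    using assms inj_onD[OF inj_on_frustum_to_cube] by blast
  moreover have "2 + axis k (- 1) \<bullet> x > 0" "2 + axis k (- 1) \<bullet> y > 0"
    using assms by (auto simp: inner_axis' frustum_def)
  ultimately show ?thesis
    unfolding frustum_to_cube_def using projective_open_segment by blast
qed simp

text \<open>The inverse map also sends open segments into open segments; applied to a point of the
  image segment it yields the reverse inclusion.\<close>

lemma cube_to_frustum_open_segment:
  assumes "x \<in> cbox 0 1" "y \<in> cbox 0 1"
  shows "cube_to_frustum k ` open_segment x y =
    open_segment (cube_to_frustum k x) (cube_to_frustum k y)"
proof (rule antisym[OF cube_to_frustum_open_segment_subset[OF assms]], rule subsetI)
  fix z assume z: "z \<in> open_segment (cube_to_frustum k x) (cube_to_frustum k y)"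
  have xy: "cube_to_frustum k x \<in> frustum k" "cube_to_frustum k y \<in> frustum k"
    using assms cube_to_frustum_mem by auto
  then have "z \<in> frustum k"
    using z convex_frustum[of k] unfolding convex_contains_open_segment by blast
  moreover have "frustum_to_cube k z \<in> open_segment x y"
    using frustum_to_cube_open_segment_subset[OF xy] z assms by (auto simp: cube_to_frustum_to_cube)
  ultimately show "z \<in> cube_to_frustum k ` open_segment x y"
    by (metis frustum_to_cube_to_frustum image_eqI)
qed

lemma frustum_to_cube_open_segment:
  assumes "x \<in> frustum k" "y \<in> frustum k"
  shows "frustum_to_cube k ` open_segment x y =
    open_segment (frustum_to_cube k x) (frustum_to_cube k y)"
proof (rule antisym[OF frustum_to_cube_open_segment_subset[OF assms]], rule subsetI)
  fix z assume z: "z \<in> open_segment (frustum_to_cube k x) (frustum_to_cube k y)"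
  have xy: "frustum_to_cube k x \<in> cbox 0 1" "frustum_to_cube k y \<in> cbox 0 1"
    using assms frustum_to_cube_mem by auto
  then have "z \<in> cbox 0 1"
    using z convex_box(1)[of 0 1] unfolding convex_contains_open_segment by blast
  moreover have "cube_to_frustum k z \<in> open_segment x y"
    using cube_to_frustum_open_segment_subset[OF xy, of k] z assms by (auto simp: frustum_to_cube_to_frustum)
  ultimately show "z \<in> frustum_to_cube k ` open_segment x y"
    by (metis cube_to_frustum_to_cube image_eqI)
qed

lemma face_of_frustum_to_cube:
  "F face_of frustum k \<Longrightarrow> frustum_to_cube k ` F face_of cbox 0 1"
  using image_face_of[OF _ frustum_to_cube_open_segment inj_on_frustum_to_cube convex_frustum]
  by (simp add: frustum_to_cube_image)

lemma face_of_cube_to_frustum: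
  "F face_of cbox 0 1 \<Longrightarrow> cube_to_frustum k ` F face_of frustum k"
  using image_face_of[OF _ cube_to_frustum_open_segment inj_on_cube_to_frustum convex_box(1)]
  by (simp add: cube_to_frustum_image)

lemma combinatorially_isomorphic_frustum_cube:
  fixes k :: "'n::finite"
  shows "combinatorially_isomorphic (frustum k) (cbox (0 :: real ^ 'n) 1)"
  unfolding combinatorially_isomorphic_def
proof (intro exI[of _ "(`) (frustum_to_cube k)"] conjI allI impI)
  show "bij_betw ((`) (frustum_to_cube k)) {F. F face_of frustum k} {G. G face_of cbox 0 1}"
  proof (rule bij_betw_byWitness[where f' = "(`) (cube_to_frustum k)"])
    show "\<forall>F\<in>{F. F face_of frustum k}. cube_to_frustum k ` frustum_to_cube k ` F = F"
    proof
      fix F assume "F \<in> {F. F face_of frustum k}"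
      then have "F \<subseteq> frustum k" using face_of_imp_subset by auto
      then have "cube_to_frustum k (frustum_to_cube k x) = x" if "x \<in> F" for x
        using that frustum_to_cube_to_frustum by blast
      then show "cube_to_frustum k ` frustum_to_cube k ` F = F" by (simp add: image_image)
    qed
    show "\<forall>F\<in>{G. G face_of cbox 0 1}. frustum_to_cube k ` cube_to_frustum k ` F = F"
    proof
      fix F :: "(real ^ 'n) set" assume "F \<in> {G. G face_of cbox 0 1}"
      then have "F \<subseteq> cbox 0 1" using face_of_imp_subset by auto
      then have "frustum_to_cube k (cube_to_frustum k x) = x" if "x \<in> F" for x
        using that cube_to_frustum_to_cube by blast
      then show "frustum_to_cube k ` cube_to_frustum k ` F = F" by (simp add: image_image)
    qed
  qed (use face_of_frustum_to_cube face_of_cube_to_frustum in auto)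
  show "F \<subseteq> G \<longleftrightarrow> frustum_to_cube k ` F \<subseteq> frustum_to_cube k ` G"
    if "F face_of frustum k" "G face_of frustum k" for F G
    using that inj_on_image_subset_iff[OF inj_on_frustum_to_cube] face_of_imp_subset by metis
qed

section \<open>Vertices, dimension and arcs of the frustum\<close>

lemma extreme_point_of_frustum_to_cube:
  "v extreme_point_of frustum k \<Longrightarrow> frustum_to_cube k v extreme_point_of cbox 0 1"
  using face_of_frustum_to_cube[of "{v}" k] by (simp add: face_of_singleton)

lemma finite_extreme_points_frustum:
  fixes k :: "'n::finite"
  shows "finite {v. v extreme_point_of frustum k}"
proof -
  let ?V = "{x :: real ^ 'n. \<forall>i. x $ i \<in> {0, 1}}"
  have "{v. v extreme_point_of frustum k} \<subseteq> cube_to_frustum k ` ?V"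
  proof
    fix v assume "v \<in> {v. v extreme_point_of frustum k}"
    then have v: "v extreme_point_of frustum k" by simp
    then have "frustum_to_cube k v \<in> ?V"
      using extreme_point_of_unit_cube[OF extreme_point_of_frustum_to_cube[OF v]] by simp
    moreover have "v = cube_to_frustum k (frustum_to_cube k v)"
      using v frustum_to_cube_to_frustum[of v k] by (simp add: extreme_point_of_def)
    ultimately show "v \<in> cube_to_frustum k ` ?V" by blast
  qed
  moreover have "finite ?V"
  proof (rule finite_surj[where f = "\<lambda>A. \<chi> i. if i \<in> A then 1 else 0"])
    show "?V \<subseteq> (\<lambda>A. \<chi> i. if i \<in> A then 1 else 0) ` (UNIV :: 'n set set)"
    proof
      fix x assume "x \<in> ?V"
      then have "x = (\<chi> i. if i \<in> {i. x $ i = 1} then 1 else 0)" by (auto simp: vec_eq_iff)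
      then show "x \<in> (\<lambda>A. \<chi> i. if i \<in> A then 1 else 0) ` UNIV" by blast
    qed
  qed simp
  ultimately show ?thesis using finite_surj by blast
qed

text \<open>The frustum is compact as a continuous image of the cube, hence by Krein-Milman the
  convex hull of its finitely many extreme points.\<close>

lemma polytope_frustum: "polytope (frustum k)"
proof -
  have "continuous_on (cbox 0 1) (cube_to_frustum k)"
    unfolding cube_to_frustum_def
    by (intro continuous_intros ballI) (simp add: inner_axis' mem_box_cart add_nonneg_eq_0_iff)
  then have "compact (frustum k)"
    using compact_continuous_image[OF _ compact_cbox] cube_to_frustum_image by metis
  then show ?thesis
    unfolding polytope_def
    using Krein_Milman_Minkowski[OF _ convex_frustum] finite_extreme_points_frustum by blast
qed

lemma aff_dim_frustum:
  fixes k :: "'n::finite"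
  shows "aff_dim (frustum k) = int CARD('n)"
proof -
  have "cbox 0 1 \<subseteq> frustum k"
  proof
    fix x :: "real ^ 'n"
    assume "x \<in> cbox 0 1"
    then have "0 \<le> x $ j \<and> x $ j \<le> 1" for j by (simp add: mem_box_cart)
    then show "x \<in> frustum k" unfolding frustum_def by (smt (verit) mem_Collect_eq)
  qed
  moreover have "aff_dim (cbox 0 (1 :: real ^ 'n)) = int CARD('n)"
    using aff_dim_nonempty_interior[of "cbox 0 (1 :: real ^ 'n)"]
    by (simp add: interior_cbox interval_ne_empty_cart)
  ultimately have "int CARD('n) \<le> aff_dim (frustum k)" using aff_dim_subset by metis
  moreover have "aff_dim (frustum k) \<le> int CARD('n)"
    using aff_dim_le_DIM[of "frustum k"] by simp
  ultimately show ?thesis by simp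
qed

text \<open>The 2-colouring is pulled back from the cube. It needs no change, because
  \<open>frustum_to_cube\<close> multiplies each point by a positive factor and so keeps its zero
  coordinates.\<close>

lemma odd_nonzero_count_frustum_arc:
  assumes "monotone_arc (frustum k) c u v"
  shows "odd (nonzero_count u + nonzero_count v)"
proof -
  let ?g = "frustum_to_cube k"
  have face: "closed_segment u v face_of frustum k"
    and u: "u extreme_point_of frustum k" and v: "v extreme_point_of frustum k" and ne: "u \<noteq> v"
    using assms by (auto simp: monotone_arc_def edge_of_def)
  have mem: "u \<in> frustum k" "v \<in> frustum k"
    using u v by (auto simp: extreme_point_of_def)
  have "?g ` closed_segment u v = closed_segment (?g u) (?g v)"
    using frustum_to_cube_open_segment[OF mem] by (simp add: closed_segment_eq_open)
  then have "odd (nonzero_count (?g u) + nonzero_count (?g v))"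
    using odd_nonzero_count_unit_cube_edge[of "?g u" "?g v"] face_of_frustum_to_cube[OF face]
      extreme_point_of_frustum_to_cube[OF u] extreme_point_of_frustum_to_cube[OF v]
      inj_onD[OF inj_on_frustum_to_cube _ mem] ne by auto
  moreover have "nonzero_count (?g x) = nonzero_count x" if "x \<in> frustum k" for x
    using that by (auto simp: nonzero_count_def frustum_to_cube_nth frustum_def)
  ultimately show ?thesis using mem by simp
qed

section \<open>Two coherent paths on the frustum\<close>

lemma inner_vec_remove:
  fixes x y :: "real ^ 'n"
  shows "x \<bullet> y = x $ k * y $ k + (\<Sum>j\<in>UNIV - {k}. x $ j * y $ j)"
  by (simp add: inner_vec_def sum.remove[of UNIV k])

text \<open>For fixed \<open>x $ k\<close> a linear functional is maximised over the frustum coordinate by coordinate,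
  and the resulting maximum is affine in \<open>x $ k\<close>.\<close>

lemma support_face_frustum:
  fixes k :: "'n::finite" and w :: "real ^ 'n"
  defines "G \<equiv> (\<Sum>j\<in>UNIV - {k}. max 0 (w $ j))"
  shows "support_face (frustum k) w =
    {x \<in> frustum k. (\<forall>j. j \<noteq> k \<longrightarrow> (w $ j > 0 \<longrightarrow> x $ j = 2 - x $ k) \<and> (w $ j < 0 \<longrightarrow> x $ j = 0)) \<and>
      (w $ k < G \<longrightarrow> x $ k = 0) \<and> (G < w $ k \<longrightarrow> x $ k = 1)}"
    (is "_ = {x \<in> _. ?C x \<and> ?T x}")
\<comment> \<open>At fixed \<open>x $ k\<close> the best value is
  \<open>G * (2 - x $ k) + x $ k * w $ k\<close>, that is
  \<open>2 * G + x $ k * (w $ k - G)\<close>; maximising over \<open>x $ k\<close> in [0, 1] gives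
  \<open>M\<close>. The terms \<open>?d\<close> and \<open>?e\<close> below split the gap to
  \<open>M\<close> into nonnegative deficits whose vanishing is \<open>?C\<close> and
  \<open>?T\<close>.\<close>
proof (rule support_face_eqI[where M = "2 * G + max 0 (w $ k - G)"])
  let ?d = "\<lambda>x j. max 0 (w $ j) * (2 - x $ k) - x $ j * w $ j"
  let ?e = "\<lambda>x. max 0 (w $ k - G) - x $ k * (w $ k - G)"
  have eq: "2 * G + max 0 (w $ k - G) - x \<bullet> w = (\<Sum>j\<in>UNIV - {k}. ?d x j) + ?e x" for x
  proof -
    have "(\<Sum>j\<in>UNIV - {k}. ?d x j) = G * (2 - x $ k) - (\<Sum>j\<in>UNIV - {k}. x $ j * w $ j)"
      unfolding G_def by (simp add: sum_subtractf sum_distrib_right)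
    then show ?thesis unfolding inner_vec_remove[of x w k] by (simp add: algebra_simps)
  qed
  have d: "?d x j \<ge> 0"
    "?d x j = 0 \<longleftrightarrow> (w $ j > 0 \<longrightarrow> x $ j = 2 - x $ k) \<and> (w $ j < 0 \<longrightarrow> x $ j = 0)"
    if "x \<in> frustum k" "j \<noteq> k" for x j
  proof -
    have x: "0 \<le> x $ j" "x $ j \<le> 2 - x $ k" using that by (auto simp: frustum_def)
    consider "w $ j > 0" | "w $ j = 0" | "w $ j < 0" by linarith
    then have "?d x j \<ge> 0 \<and>
      (?d x j = 0 \<longleftrightarrow> (w $ j > 0 \<longrightarrow> x $ j = 2 - x $ k) \<and> (w $ j < 0 \<longrightarrow> x $ j = 0))"
    proof cases
      case 1
      then have "?d x j = w $ j * (2 - x $ k - x $ j)" by (simp add: algebra_simps)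
      then show ?thesis using 1 x by auto
    next
      case 3
      then show ?thesis using x by (auto simp: mult_nonneg_nonpos)
    qed auto
    then show "?d x j \<ge> 0"
      "?d x j = 0 \<longleftrightarrow> (w $ j > 0 \<longrightarrow> x $ j = 2 - x $ k) \<and> (w $ j < 0 \<longrightarrow> x $ j = 0)" by auto
  qed
  have e: "?e x \<ge> 0 \<and> (?e x = 0 \<longleftrightarrow> ?T x)" if "x \<in> frustum k" for x
  proof -
    have x: "0 \<le> x $ k" "x $ k \<le> 1" using that by (auto simp: frustum_def)
    consider "w $ k > G" | "w $ k = G" | "w $ k < G" by linarith
    then show ?thesis
    proof cases
      case 1
      then have "?e x = (w $ k - G) * (1 - x $ k)" by (simp add: algebra_simps)
      then show ?thesis using 1 x by auto
    next
      case 3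
      then have "?e x = (G - w $ k) * x $ k" by (simp add: algebra_simps)
      then show ?thesis using 3 x by auto
    qed auto
  qed
  have D: "(\<Sum>j\<in>UNIV - {k}. ?d x j) \<ge> 0" "(\<Sum>j\<in>UNIV - {k}. ?d x j) = 0 \<longleftrightarrow> ?C x"
    if "x \<in> frustum k" for x
  proof -
    show "(\<Sum>j\<in>UNIV - {k}. ?d x j) \<ge> 0" using d(1)[OF that] by (intro sum_nonneg) auto
    have "(\<Sum>j\<in>UNIV - {k}. ?d x j) = 0 \<longleftrightarrow> (\<forall>j\<in>UNIV - {k}. ?d x j = 0)"
      using d(1)[OF that] by (intro sum_nonneg_eq_0_iff) auto
    also have "\<dots> \<longleftrightarrow> ?C x" using d(2)[OF that] by blast
    finally show "(\<Sum>j\<in>UNIV - {k}. ?d x j) = 0 \<longleftrightarrow> ?C x" .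
  qed
  show "x \<bullet> w \<le> 2 * G + max 0 (w $ k - G)" if "x \<in> frustum k" for x
    using eq[of x] D(1)[OF that] e[OF that] by linarith
  show "x \<in> frustum k \<and> x \<bullet> w = 2 * G + max 0 (w $ k - G) \<longleftrightarrow> x \<in> {x \<in> frustum k. ?C x \<and> ?T x}" for x
  proof (cases "x \<in> frustum k")
    case True
    have "x \<bullet> w = 2 * G + max 0 (w $ k - G) \<longleftrightarrow> (\<Sum>j\<in>UNIV - {k}. ?d x j) = 0 \<and> ?e x = 0"
      using eq[of x] D(1)[OF True] e[OF True] by linarith
    then show ?thesis using D(2)[OF True] e[OF True] True by simp
  qed simp
  \<comment> \<open>A maximiser: \<open>\<tau>\<close> picks the favoured facet, and the other
    coordinates go to the end preferred by their weights.\<close>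
  define \<tau> :: real where "\<tau> = (if w $ k < G then 0 else 1)"
  have "(\<chi> j. if j = k then \<tau> else if w $ j > 0 then 2 - \<tau> else 0) \<in> {x \<in> frustum k. ?C x \<and> ?T x}"
    by (auto simp: frustum_def \<tau>_def)
  then show "{x \<in> frustum k. ?C x \<and> ?T x} \<noteq> {}" by blast
qed

text \<open>The ranking \<open>r\<close> fixes the order in which the coordinates other than
  \<open>k\<close> are raised along both paths; \<open>m\<close> is \<open>d - 1\<close>.\<close>

locale ranked_coordinates =
  fixes k :: "'n::finite" and r :: "'n \<Rightarrow> nat" and m :: nat
  assumes bij: "bij_betw r (UNIV - {k}) {..<m}" and m_pos: "m > 0"
begin

definition c :: "real ^ 'n" where "c = (\<chi> j. if j = k then 1 else 2)"

text \<open>Raising the coordinate \<open>j\<close> projects to slope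
  \<open>\<omega> $ j / c $ j = m - r j\<close>, so lower ranks have steeper edges and come first.
  The free entry \<open>\<kappa>\<close> controls which of the two facets is preferred.\<close>

definition \<omega> :: "real \<Rightarrow> real ^ 'n" where
  "\<omega> \<kappa> = (\<chi> j. if j = k then \<kappa> else 2 * (real m - real (r j)))"

definition V :: "real \<Rightarrow> nat \<Rightarrow> real ^ 'n" where
  "V \<tau> i = (\<chi> j. if j = k then \<tau> else if r j < i then 2 - \<tau> else 0)"

lemma sum_rank: "(\<Sum>j\<in>UNIV - {k}. h (r j)) = (\<Sum>i<m. h i)"
  using sum.reindex_bij_betw[OF bij] .

lemma rank_less: "j \<noteq> k \<Longrightarrow> r j < m"
  using bij by (auto simp: bij_betw_def)

lemma rank_exists:
  assumes "i < m" obtains j where "j \<noteq> k" "r j = i"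
proof -
  have "i \<in> r ` (UNIV - {k})" using assms bij by (simp add: bij_betw_def)
  then show ?thesis using that by auto
qed

lemma rank_eqD: "r j = r l \<Longrightarrow> j \<noteq> k \<Longrightarrow> l \<noteq> k \<Longrightarrow> j = l"
  using bij by (auto simp: bij_betw_def inj_on_def)

lemma V_nth: "V \<tau> i $ k = \<tau>" "j \<noteq> k \<Longrightarrow> V \<tau> i $ j = (if r j < i then 2 - \<tau> else 0)"
  by (auto simp: V_def)

lemma V_height:
  assumes "i \<le> m"
  shows "V \<tau> i \<bullet> c = \<tau> + 2 * (2 - \<tau>) * i"
proof -
  have "(\<Sum>j\<in>UNIV - {k}. V \<tau> i $ j * c $ j) = (\<Sum>j\<in>UNIV - {k}. if r j < i then 2 * (2 - \<tau>) else 0)"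
    by (intro sum.cong) (auto simp: V_def c_def)
  also have "\<dots> = (\<Sum>l<m. if l < i then 2 * (2 - \<tau>) else 0)" by (rule sum_rank)
  also have "\<dots> = (\<Sum>l<i. 2 * (2 - \<tau>))"
    using assms by (intro sum.mono_neutral_cong_right) auto
  finally show ?thesis
    by (simp add: inner_vec_remove[of _ _ k]) (simp add: V_def c_def)
qed

text \<open>Only the coordinate of rank \<open>i\<close> is free; its fraction of the upper bound
  \<open>2 - \<tau>\<close> is the segment parameter.\<close>

lemma horizontal_edge:
  assumes i: "i < m" and \<tau>: "0 \<le> \<tau>" "\<tau> \<le> 1"
  shows "{x \<in> frustum k. (\<forall>j. j \<noteq> k \<longrightarrow> (r j < i \<longrightarrow> x $ j = 2 - x $ k) \<and> (i < r j \<longrightarrow> x $ j = 0)) \<and> x $ k = \<tau>}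
    = closed_segment (V \<tau> i) (V \<tau> (Suc i))" (is "?L = ?R")
proof (intro set_eqI iffI)
  fix x assume x: "x \<in> ?L"
  obtain l where l: "l \<noteq> k" "r l = i" using rank_exists[OF i] .
  define u where "u = x $ l / (2 - \<tau>)"
  have xl: "0 \<le> x $ l" "x $ l \<le> 2 - \<tau>" using x l by (auto simp: frustum_def)
  have u: "0 \<le> u" "u \<le> 1" "x $ l = u * (2 - \<tau>)" using xl \<tau> by (auto simp: u_def)
  have "x $ j = ((1 - u) *\<^sub>R V \<tau> i + u *\<^sub>R V \<tau> (Suc i)) $ j" for j
  proof (cases "j = k")
    case True then show ?thesis using x by (simp add: V_nth algebra_simps)
  next
    case False
    then consider "r j < i" | "j = l" | "i < r j"
      using rank_eqD[of j l] l by (metis linorder_neqE_nat)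
    then show ?thesis
      by cases (use x False l u in \<open>auto simp: V_nth algebra_simps\<close>)
  qed
  then show "x \<in> ?R" unfolding in_segment using u by (metis vec_eq_iff)
next
  fix x assume "x \<in> ?R"
  then obtain u where u: "0 \<le> u" "u \<le> 1" "x = (1 - u) *\<^sub>R V \<tau> i + u *\<^sub>R V \<tau> (Suc i)"
    by (auto simp: in_segment)
  have k: "x $ k = \<tau>" by (simp add: u V_nth algebra_simps)
  have j: "x $ j = (if r j < i then 2 - \<tau> else if r j = i then u * (2 - \<tau>) else 0)" if "j \<noteq> k" for j
    using that by (auto simp: u V_nth algebra_simps)
  have "0 \<le> u * (2 - \<tau>)" "u * (2 - \<tau>) \<le> 2 - \<tau>"
    using u \<tau> by (auto simp: mult_left_le_one_le)
  then show "x \<in> ?L" using k j \<tau> by (auto simp: frustum_def)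
qed

lemma bottom_edge:
  "{x \<in> frustum k. \<forall>j. j \<noteq> k \<longrightarrow> x $ j = 0} = closed_segment (V 0 0) (V 1 0)" (is "?L = ?R")
proof (intro set_eqI iffI)
  fix x assume x: "x \<in> ?L"
  have "x = (1 - x $ k) *\<^sub>R V 0 0 + x $ k *\<^sub>R V 1 0"
    using x unfolding vec_eq_iff by (auto simp: V_def)
  then show "x \<in> ?R" unfolding in_segment using x by (auto simp: frustum_def)
next
  fix x assume "x \<in> ?R"
  then show "x \<in> ?L" by (auto simp: in_segment frustum_def V_def)
qed

text \<open>The segment is oriented by increasing height: as \<open>x $ k\<close> drops from 1 to 0,
  the other coordinates grow from 1 to 2. The parameter is therefore
  \<open>1 - x $ k\<close>.\<close>

lemma top_edge:
  "{x \<in> frustum k. \<forall>j. j \<noteq> k \<longrightarrow> x $ j = 2 - x $ k} = closed_segment (V 1 m) (V 0 m)" (is "?L = ?R")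
proof (intro set_eqI iffI)
  fix x assume x: "x \<in> ?L"
  have "x = (1 - (1 - x $ k)) *\<^sub>R V 1 m + (1 - x $ k) *\<^sub>R V 0 m"
    using x rank_less unfolding vec_eq_iff by (auto simp: V_def)
  moreover have "0 \<le> 1 - x $ k" "1 - x $ k \<le> 1" using x by (auto simp: frustum_def)
  ultimately show "x \<in> ?R" unfolding in_segment by blast
next
  fix x assume "x \<in> ?R"
  then show "x \<in> ?L" using rank_less by (auto simp: in_segment frustum_def V_def)
qed

lemma min_face: "support_face (frustum k) (- c) = {V 0 0}"
proof -
  have "(\<Sum>j\<in>UNIV - {k}. max 0 ((- c) $ j)) = 0" by (intro sum.neutral) (auto simp: c_def)
  then show ?thesis
    unfolding support_face_frustum by (auto simp: c_def V_def vec_eq_iff frustum_def)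
qed

text \<open>Raising \<open>x $ k\<close> by one gains 1 but lowers the bounds of the other
  coordinates at a cost of \<open>2 * m\<close>, so the maximum lies at
  \<open>x $ k = 0\<close>.\<close>

lemma max_face: "support_face (frustum k) c = {V 0 m}"
proof -
  have "(\<Sum>j\<in>UNIV - {k}. max 0 (c $ j)) = (\<Sum>j\<in>UNIV - {k}. 2)"
    by (intro sum.cong) (auto simp: c_def)
  also have "\<dots> = 2 * real m"
    using sum_rank[of "\<lambda>_. 2 :: real"] by (simp del: sum_constant) simp
  finally show ?thesis
    unfolding support_face_frustum using m_pos rank_less
    by (auto simp: c_def V_def vec_eq_iff frustum_def)
qed

text \<open>At the coordinate of rank \<open>m - 1\<close> both vectors equal 2, so the only
  possible factor is 1, and the entries 1 and \<open>\<kappa>\<close> at \<open>k\<close> exclude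
  it.\<close>

lemma independent_c_\<omega>:
  assumes "\<kappa> \<noteq> 1"
  shows "c \<noteq> \<omega> \<kappa>" "independent {c, \<omega> \<kappa>}"
proof -
  obtain l where l: "l \<noteq> k" "r l = m - 1" using rank_exists[of "m - 1"] m_pos by auto
  have \<omega>: "\<omega> \<kappa> $ l = 2" "\<omega> \<kappa> $ k = \<kappa>" using l m_pos by (auto simp: \<omega>_def of_nat_diff)
  have c: "c $ l = 2" "c $ k = 1" using l by (auto simp: c_def)
  have *: "c \<noteq> t *\<^sub>R \<omega> \<kappa>" for t
  proof
    assume e: "c = t *\<^sub>R \<omega> \<kappa>"
    have "t = 1" using arg_cong[OF e, of "\<lambda>x. x $ l"] \<omega> c by simp
    then show False using arg_cong[OF e, of "\<lambda>x. x $ k"] \<omega> c assms by simp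
  qed
  show "c \<noteq> \<omega> \<kappa>" using *[of 1] by simp
  moreover have "\<omega> \<kappa> \<noteq> 0" using \<omega> by auto
  ultimately show "independent {c, \<omega> \<kappa>}"
    using * by (auto simp: independent_insert span_singleton)
qed

text \<open>With slope \<open>m - i\<close> the coordinates of rank below \<open>i\<close> get positive weight, those of rank above
  \<open>i\<close> negative weight; \<open>\<kappa>\<close> decides whether the maximum is attained at \<open>x $ k = 0\<close> or \<open>x $ k = 1\<close>.\<close>

lemma weight_nth:
  assumes "w = \<omega> \<kappa> - (real m - real i) *\<^sub>R c"
  shows "w $ k = \<kappa> - (real m - real i)" "j \<noteq> k \<Longrightarrow> w $ j = 2 * (real i - real (r j))"
  by (simp_all add: assms \<omega>_def c_def algebra_simps)

text \<open>Each of the \<open>m\<close> positive parts is at most \<open>2 * m\<close>. The crude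
  bound tells how large \<open>\<kappa>\<close> must be to push the maximum to
  \<open>x $ k = 1\<close>.\<close>

lemma positive_weight_bound:
  assumes "i \<le> m" "w = \<omega> \<kappa> - (real m - real i) *\<^sub>R c"
  shows "(\<Sum>j\<in>UNIV - {k}. max 0 (w $ j)) \<le> 2 * (real m)\<^sup>2"
proof -
  have "(\<Sum>j\<in>UNIV - {k}. max 0 (w $ j)) \<le> (\<Sum>j\<in>UNIV - {k}. 2 * real m)"
    using assms(1) by (intro sum_mono) (auto simp: weight_nth(2)[OF assms(2)])
  also have "\<dots> = 2 * (real m)\<^sup>2"
    using sum_rank[of "\<lambda>_. 2 * real m"] by (simp del: sum_constant) (simp add: power2_eq_square)
  finally show ?thesis .
qed

text \<open>With \<open>\<kappa> = 0\<close> the weight at \<open>k\<close> is negative at every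
  slope used, so the maximum stays in the facet \<open>x $ k = 0\<close>.\<close>

lemma short_path: "upper_path (frustum k) c (\<omega> 0) (V 0) (\<lambda>i. real m - real i) m"
proof
  fix i assume i: "i < m"
  define w where "w = \<omega> 0 - (real m - real i) *\<^sub>R c"
  have "0 \<le> (\<Sum>j\<in>UNIV - {k}. max 0 (w $ j))" by (intro sum_nonneg) auto
  moreover have "w $ k < 0" using i by (simp add: weight_nth[OF w_def])
  ultimately have "w $ k < (\<Sum>j\<in>UNIV - {k}. max 0 (w $ j))" by linarith
  then have "support_face (frustum k) w =
    {x \<in> frustum k. (\<forall>j. j \<noteq> k \<longrightarrow> (r j < i \<longrightarrow> x $ j = 2 - x $ k) \<and> (i < r j \<longrightarrow> x $ j = 0)) \<and> x $ k = 0}"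
    unfolding support_face_frustum by (intro Collect_cong) (auto simp: weight_nth[OF w_def])
  then show "support_face (frustum k) (\<omega> 0 - (real m - real i) *\<^sub>R c) = closed_segment (V 0 i) (V 0 (Suc i))"
    unfolding w_def using horizontal_edge[OF i, of 0] by simp
  show "V 0 i \<bullet> c < V 0 (Suc i) \<bullet> c" using i by (simp add: V_height)
qed (auto simp: convex_frustum m_pos min_face max_face)

text \<open>Large enough for two purposes: after subtracting a slope \<open>m - i\<close> the weight
  at \<open>k\<close> still exceeds the bound \<open>2 * m^2\<close>, and as a slope it is steeper
  than all slopes \<open>m - i\<close>.\<close>

definition high :: real where "high = 2 * (real m)\<^sup>2 + real m + 1"

text \<open>The slope at which the facets \<open>x $ k = 0\<close> and \<open>x $ k = 1\<close> tie for the maximum.\<close>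

definition last_slope :: real where
  "last_slope = ((\<Sum>i<m. 2 * (real m - real i)) - high) / (2 * real m - 1)"

text \<open>One edge leads up to \<open>x $ k = 1\<close>, which shifts the indices there by one;
  \<open>m\<close> edges cross that facet and one returns, \<open>m + 2\<close> in all.\<close>

definition long_vertex :: "nat \<Rightarrow> real ^ 'n" where
  "long_vertex i = (if i = 0 then V 0 0 else if i \<le> Suc m then V 1 (i - 1) else V 0 m)"

definition long_slope :: "nat \<Rightarrow> real" where
  "long_slope i = (if i = 0 then high else if i \<le> m then real m - real (i - 1) else last_slope)"

text \<open>Negativity places the returning edge after all crossing edges, whose slopes are at least
  1, and makes all weights other than that of \<open>k\<close> positive on it.\<close>

lemma last_slope_neg: "last_slope < 0"
proof -
  have "(\<Sum>i<m. 2 * (real m - real i)) \<le> (\<Sum>i<m. 2 * real m)" by (intro sum_mono) auto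
  also have "\<dots> < high" by (simp add: high_def power2_eq_square)
  finally show ?thesis using m_pos by (simp add: last_slope_def divide_neg_pos)
qed

text \<open>At slope \<open>high\<close> the weight at \<open>k\<close> vanishes and all others are
  negative, so the other coordinates are 0 while \<open>x $ k\<close> is free.\<close>

lemma first_edge: "support_face (frustum k) (\<omega> high - high *\<^sub>R c) = closed_segment (V 0 0) (V 1 0)"
proof -
  define w where "w = \<omega> high - high *\<^sub>R c"
  have neg: "w $ j < 0" if "j \<noteq> k" for j
  proof -
    have "real m < high" unfolding high_def by (simp add: add_nonneg_pos)
    then show ?thesis using that by (simp add: w_def \<omega>_def c_def)
  qed
  then have "(\<Sum>j\<in>UNIV - {k}. max 0 (w $ j)) = 0"
    by (intro sum.neutral) (auto intro: max_absorb1 less_imp_le)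
  moreover have "w $ k = 0" by (simp add: w_def \<omega>_def c_def)
  moreover have "(w $ j > 0 \<longrightarrow> x $ j = 2 - x $ k) \<and> (w $ j < 0 \<longrightarrow> x $ j = 0) \<longleftrightarrow> x $ j = 0"
    if "j \<noteq> k" for j and x :: "real ^ 'n" using neg[OF that] by auto
  ultimately have "support_face (frustum k) w = {x \<in> frustum k. \<forall>j. j \<noteq> k \<longrightarrow> x $ j = 0}"
    unfolding support_face_frustum by (intro Collect_cong) (simp cong: imp_cong)
  then show ?thesis unfolding w_def by (simp only: bottom_edge)
qed

lemma last_edge:
  "support_face (frustum k) (\<omega> high - last_slope *\<^sub>R c) = closed_segment (V 1 m) (V 0 m)"
proof -
  define w where "w = \<omega> high - last_slope *\<^sub>R c"
  have wj: "w $ j = 2 * (real m - real (r j)) - 2 * last_slope" if "j \<noteq> k" for j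
    using that by (simp add: w_def \<omega>_def c_def)
  have pos: "w $ j > 0" if "j \<noteq> k" for j
    using wj[OF that] rank_less[OF that] last_slope_neg by simp
  have "(\<Sum>j\<in>UNIV - {k}. max 0 (w $ j)) =
      (\<Sum>j\<in>UNIV - {k}. 2 * (real m - real (r j)) - 2 * last_slope)"
    by (intro sum.cong refl) (use pos wj in \<open>fastforce simp: max_def\<close>)
  also have "\<dots> = (\<Sum>i<m. 2 * (real m - real i)) - 2 * real m * last_slope"
    unfolding sum_rank[of "\<lambda>i. 2 * (real m - real i) - 2 * last_slope"] by (simp add: sum_subtractf)
  \<comment> \<open>The tie equation solved by \<open>last_slope\<close>; its coefficient
    \<open>2 * m - 1\<close> collects \<open>2 * m\<close> from the other coordinates and 1 from
    \<open>k\<close>.\<close>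
  also have "\<dots> = high - last_slope"
  proof -
    have "2 * real m - 1 \<noteq> 0" using m_pos by linarith
    then have "last_slope * (2 * real m - 1) = (\<Sum>i<m. 2 * (real m - real i)) - high"
      by (simp add: last_slope_def)
    then show ?thesis by (simp add: algebra_simps)
  qed
  finally have "(\<Sum>j\<in>UNIV - {k}. max 0 (w $ j)) = w $ k" by (simp add: w_def \<omega>_def c_def)
  moreover have "(w $ j > 0 \<longrightarrow> x $ j = 2 - x $ k) \<and> (w $ j < 0 \<longrightarrow> x $ j = 0) \<longleftrightarrow> x $ j = 2 - x $ k"
    if "j \<noteq> k" for j and x :: "real ^ 'n" using pos[OF that] by auto
  ultimately have "support_face (frustum k) w = {x \<in> frustum k. \<forall>j. j \<noteq> k \<longrightarrow> x $ j = 2 - x $ k}"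
    unfolding support_face_frustum by (intro Collect_cong) (simp cong: imp_cong)
  then show ?thesis unfolding w_def by (simp only: top_edge)
qed

lemma middle_edge:
  assumes i: "i < m"
  shows "support_face (frustum k) (\<omega> high - (real m - real i) *\<^sub>R c) = closed_segment (V 1 i) (V 1 (Suc i))"
proof -
  define w where "w = \<omega> high - (real m - real i) *\<^sub>R c"
  have "(\<Sum>j\<in>UNIV - {k}. max 0 (w $ j)) \<le> 2 * (real m)\<^sup>2"
    using positive_weight_bound[OF _ w_def] i by simp
  moreover have "2 * (real m)\<^sup>2 < w $ k" by (simp add: weight_nth[OF w_def] high_def)
  ultimately have "(\<Sum>j\<in>UNIV - {k}. max 0 (w $ j)) < w $ k" by linarith
  then have "support_face (frustum k) w =
    {x \<in> frustum k. (\<forall>j. j \<noteq> k \<longrightarrow> (r j < i \<longrightarrow> x $ j = 2 - x $ k) \<and> (i < r j \<longrightarrow> x $ j = 0)) \<and> x $ k = 1}"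
    unfolding support_face_frustum by (intro Collect_cong) (auto simp: weight_nth[OF w_def])
  then show ?thesis unfolding w_def using horizontal_edge[OF i, of 1] by simp
qed

lemma long_path: "upper_path (frustum k) c (\<omega> high) long_vertex long_slope (m + 2)"
proof
  fix i assume i: "i < m + 2"
  \<comment> \<open>The edge up to \<open>x $ k = 1\<close>, the edges across that facet, and the
    edge back.\<close>
  then consider "i = 0" | l where "i = Suc l" "l < m" | "i = Suc m" by (cases i) fastforce+
  then have "support_face (frustum k) (\<omega> high - long_slope i *\<^sub>R c) =
      closed_segment (long_vertex i) (long_vertex (Suc i)) \<and>
      long_vertex i \<bullet> c < long_vertex (Suc i) \<bullet> c"
  proof cases
    case 1
    then show ?thesis using first_edge by (simp add: long_slope_def long_vertex_def V_height)
  next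
    case 2
    then show ?thesis using middle_edge[of l] by (simp add: long_slope_def long_vertex_def V_height)
  next
    case 3
    then show ?thesis using last_edge m_pos
      by (simp add: long_slope_def long_vertex_def V_height)
  qed
  then show "support_face (frustum k) (\<omega> high - long_slope i *\<^sub>R c) =
      closed_segment (long_vertex i) (long_vertex (Suc i))"
    "long_vertex i \<bullet> c < long_vertex (Suc i) \<bullet> c" by auto
next
  fix i assume "Suc i < m + 2"
  moreover have "real m < high" by (simp add: high_def add_nonneg_pos)
  ultimately show "long_slope (Suc i) < long_slope i"
    using last_slope_neg m_pos by (auto simp: long_slope_def)
qed (auto simp: convex_frustum min_face max_face long_vertex_def)

end

section \<open>Counting paths\<close>

lemma monotone_path_extreme_points:
  assumes "monotone_path P c p" "v \<in> set p"
  shows "v extreme_point_of P"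
proof -
  obtain i where i: "i < length p" "v = p ! i" using assms(2) by (auto simp: in_set_conv_nth)
  show ?thesis
  proof (cases "Suc i < length p")
    case True
    then show ?thesis
      using assms(1) i successively_nth[of "monotone_arc P c" p i]
      by (auto simp: monotone_path_def monotone_arc_def)
  next
    case False
    then have "v = last p" using i by (metis Suc_lessI diff_Suc_1 last_conv_nth length_0_conv less_nat_zero_code)
    then show ?thesis using assms(1) by (auto simp: monotone_path_def max_vertex_def)
  qed
qed

text \<open>Since \<open>card\<close> is 0 on infinite sets, exhibiting a path proves a positive
  count only together with finiteness.\<close>

lemma finite_monotone_paths:
  assumes "finite {v. v extreme_point_of P}"
  shows "finite {p. monotone_path P c p \<and> path_length p = l}"
proof (rule finite_subset)
  show "{p. monotone_path P c p \<and> path_length p = l} \<subseteq>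
      {p. set p \<subseteq> {v. v extreme_point_of P} \<and> length p = Suc l}"
    using monotone_path_extreme_points by (auto simp: path_length_def monotone_path_def)
  show "finite {p. set p \<subseteq> {v. v extreme_point_of P} \<and> length p = Suc l}"
    using finite_lists_length_eq[OF assms] .
qed

text \<open>Unique extrema give both paths the same ends, so the colours of the ends cancel in the
  sum.\<close>

lemma even_frustum_path_lengths:
  assumes "unique_extrema (frustum k) c"
    and "monotone_path (frustum k) c p" "monotone_path (frustum k) c q"
  shows "even (path_length p + path_length q)"
proof -
  have *: "even (nonzero_count (hd p) + nonzero_count (last p) + path_length p)"
    if "monotone_path (frustum k) c p" for p
  proof (rule even_path_length)
    show "successively (\<lambda>u v. odd (nonzero_count u + nonzero_count v)) p"
      using that odd_nonzero_count_frustum_arc unfolding monotone_path_def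
      by (metis (no_types, lifting) successively_mono)
  qed (use that in \<open>simp add: monotone_path_def\<close>)
  have "hd p = hd q" "last p = last q"
    using assms by (auto simp: unique_extrema_def monotone_path_def)
  then show ?thesis using *[OF assms(2)] *[OF assms(3)] by simp
qed

lemma unique_extremaI:
  assumes "convex P" "support_face P (- c) = {a}" "support_face P c = {b}"
  shows "unique_extrema P c"
proof -
  have "a extreme_point_of P" "b extreme_point_of P"
    using support_face_face_of[OF assms(1)] assms(2,3) face_of_singleton by metis+
  moreover have "v \<in> P \<and> (\<forall>x\<in>P. v \<bullet> c \<le> x \<bullet> c) \<longleftrightarrow> v = a"
    "v \<in> P \<and> (\<forall>x\<in>P. x \<bullet> c \<le> v \<bullet> c) \<longleftrightarrow> v = b" for v
    using assms(2,3) by (auto simp: support_face_def set_eq_iff)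
  ultimately have "min_vertex P c v \<longleftrightarrow> v = a" "max_vertex P c v \<longleftrightarrow> v = b" for v
    unfolding min_vertex_def max_vertex_def by (metis extreme_point_of_def)+
  then show ?thesis by (simp add: unique_extrema_def)
qed

theorem theorem4p5:
  assumes "CARD('n::finite) \<ge> 3"
  shows "\<exists>(P :: (real ^ 'n) set) (c :: real ^ 'n).
           polytope P \<and> aff_dim P = int CARD('n) \<and>
           combinatorially_isomorphic P (cbox (0 :: real ^ 'n) 1) \<and>
           unique_extrema P c \<and>
           \<not> unimodal (length_sequence P (num_paths P c)) \<and>
           \<not> unimodal (length_sequence P (num_coherent_paths P c))"
proof -
  obtain k :: 'n where True by blast
  define m where "m = CARD('n) - 1"
  have "card (UNIV - {k}) = m" by (simp add: m_def card_Diff_singleton)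
  then obtain r where "bij_betw r (UNIV - {k}) {..<m}"
    using ex_bij_betw_finite_nat[of "UNIV - {k}"] by (auto simp: atLeast0LessThan)
  then interpret ranked_coordinates k r m
    using assms by unfold_locales (auto simp: m_def)
  let ?P = "frustum k"
  interpret short: upper_path ?P c "\<omega> 0" "V 0" "\<lambda>i. real m - real i" m by (rule short_path)
  interpret long: upper_path ?P c "\<omega> high" long_vertex long_slope "m + 2" by (rule long_path)
  have fin: "finite {v. v extreme_point_of ?P}" by (rule finite_extreme_points_frustum)
  have unique: "unique_extrema ?P c"
    by (rule unique_extremaI[OF convex_frustum min_face max_face])
  have "coherent ?P c (map (V 0) [0..<Suc m])"
    using short.coherent independent_c_\<omega>[of 0] by simp
  then have short: "map (V 0) [0..<Suc m] \<in> {p. monotone_path ?P c p \<and> coherent ?P c p \<and> path_length p = m}"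
    using short.monotone_path by (simp add: path_length_def del: upt_Suc)
  have "high \<noteq> 1" using m_pos by (simp add: high_def add_nonneg_eq_0_iff)
  then have "coherent ?P c (map long_vertex [0..<Suc (m + 2)])"
    using long.coherent independent_c_\<omega> by blast
  then have long: "map long_vertex [0..<Suc (m + 2)] \<in>
      {p. monotone_path ?P c p \<and> coherent ?P c p \<and> path_length p = Suc (Suc m)}"
    using long.monotone_path by (simp add: path_length_def del: upt_Suc)
  have pos: "num_paths ?P c l > 0 \<and> num_coherent_paths ?P c l > 0"
    if "p \<in> {p. monotone_path ?P c p \<and> coherent ?P c p \<and> path_length p = l}" for p l
  proof -
    have "finite {p. monotone_path ?P c p \<and> path_length p = l}"
      by (rule finite_monotone_paths[OF fin])
    moreover from this have "finite {p. monotone_path ?P c p \<and> coherent ?P c p \<and> path_length p = l}"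
      by (rule rev_finite_subset) auto
    ultimately show ?thesis
      using that unfolding num_paths_def num_coherent_paths_def card_gt_0_iff by blast
  qed
  \<comment> \<open>The short path has length \<open>m\<close>, so by parity length
    \<open>m + 1\<close> is impossible.\<close>
  have none: "path_length p \<noteq> Suc m" if "monotone_path ?P c p" for p
    using even_frustum_path_lengths[OF unique that] short by fastforce
  then have zero: "num_paths ?P c (Suc m) = 0" "num_coherent_paths ?P c (Suc m) = 0"
    by (auto simp: num_paths_def num_coherent_paths_def intro: card_eq_0_iff[THEN iffD2])
  \<comment> \<open>The long path alone visits \<open>m + 3\<close> vertices, so the entry at index
    \<open>m + 2\<close> exists in the sequence.\<close>
  have len: "Suc (Suc m) < card {v. v extreme_point_of ?P}"
    using long.card_extreme_points[OF fin] by simp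
  have dip: "\<not> unimodal (length_sequence ?P N)"
    if "N m > 0" "N (Suc m) = 0" "N (Suc (Suc m)) > 0" for N
    using not_unimodal_if_dip[of m "length_sequence ?P N"] len that by (simp add: length_sequence_def)
  have "\<not> unimodal (length_sequence ?P (num_paths ?P c))"
    "\<not> unimodal (length_sequence ?P (num_coherent_paths ?P c))"
    using zero pos[OF short] pos[OF long] by (simp_all add: dip)
  then show ?thesis
    using polytope_frustum aff_dim_frustum combinatorially_isomorphic_frustum_cube unique by blast
qed

end
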